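(* Let $n\ge 1$, let $\kappa, m_1,\dots,m_n$ be positive integers, let $p>2$ be a prime with $p\nmid\kappa$, and let $M_a$ ($1\le a\le n$) and $M_{a,b}$ ($1\le a<b\le n$) be positive integers with $M_a\equiv -\frac{m_a}{\kappa}$ and $M_{a,b}\equiv\frac{m_am_b}{2\kappa}$ modulo $p$. Fix $x_1,\dots,x_n,q\in\mathbb F_p$ and consider the vector of polynomials in $t$ over $\mathbb F_p$ $$F(t,x_1,\dots,x_n)=\Phi^{(p)}(t,x_1,\dots,x_n)\Big(\frac1{t-x_1},\dots,\frac1{t-x_n}\Big).$$ Assume that $\deg_tF(t,x_1,\dots,x_n)<2p-2$. Then $$I^{(p-1)}(x_1,\dots,x_n,q)=-\int_{\mathbb F_p}F(t,x_1,\dots,x_n).$$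
   Context: The congruences for $M_a,M_{a,b}$ are congruences after projecting $m_a,\kappa,2$ to $\mathbb F_p$ and computing the quotients in $\mathbb F_p$. Master polynomial: $\Phi^{(p)}(t,z)=\prod_{1\le a<b\le n}(z_a-z_b)^{M_{a,b}}\prod_{a=1}^n(t-z_a)^{M_a}$. Since all $M_a\geq 1$, each $\Phi^{(p)}(t,z)/(t-z_j)$ is a polynomial in $t,z$ with integer coefficients; the coordinates of $F(t,x_1,\dots,x_n)$ are obtained by reducing these polynomials modulo $p$ and substituting $z_a=x_a$. The degree $\deg_t F$ is the maximum of the degrees of the coordinates. For an integer $q$, write $$\Phi^{(p)}(t,z)\Big(\frac1{t-z_1},\dots,\frac1{t-z_n}\Big)=\sum_i\bar I^{(i)}(z,q)\,(t-q)^i,$$ with $\bar I^{(i)}(z,q)$ vectors of polynomials in $z$ with integer coefficients, and let $I^{(i)}(z,q)\in(\mathbb F_p[z_1,\dots,z_n])^n$ be the reduction of $\bar I^{(i)}(z,q)$ modulo $p$. It depends only on $q$ modulo $p$, so it is defined for $q\in\mathbb F_p$. For a polynomial $F(t)\in\mathbb F_p[t]$ set $\int_{\mathbb F_p}F(t):=\sum_{t\in\mathbb F_p}F(t)$; for vectors of polynomials the integral is taken coordinatewise. *)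

theory Defs
  imports "HOL-Library.Poly_Mapping" "Berlekamp_Zassenhaus.Finite_Field"
begin

text \<open>
  Polynomials in the variables \<open>z\<^sub>a\<close> (\<open>a :: nat\<close>) over a ring \<open>'a\<close> are finitely supported maps
  from exponents to coefficients, multiplied by the library's convolution product.
\<close>

type_synonym 'a mpoly = "(nat \<Rightarrow>\<^sub>0 nat) \<Rightarrow>\<^sub>0 'a"

definition zvar :: "nat \<Rightarrow> 'a :: zero_neq_one mpoly" where
  "zvar a = Poly_Mapping.single (Poly_Mapping.single a 1) 1"

definition mp_eval :: "(nat \<Rightarrow> 'a) \<Rightarrow> 'a :: comm_semiring_1 mpoly \<Rightarrow> 'a" where
  "mp_eval x P = (\<Sum>u \<in> Poly_Mapping.keys P.
     Poly_Mapping.lookup P u * (\<Prod>a \<in> Poly_Mapping.keys u. x a ^ Poly_Mapping.lookup u a))"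

definition mp_reduce :: "int mpoly \<Rightarrow> 'p :: prime_card mod_ring mpoly" where
  "mp_reduce = Poly_Mapping.map of_int"

text \<open>
  Throughout, \<open>M a\<close> and \<open>MM a b\<close> are the exponents \<open>M\<^sub>a\<close> and \<open>M\<^sub>a\<^sub>,\<^sub>b\<close>; only the values with
  indices in \<open>{1..n}\<close> (and \<open>a < b\<close> for \<open>MM\<close>) matter. The master polynomial is an element
  of \<open>\<int>[z][t]\<close>, the outer \<open>poly\<close> being in the variable \<open>t\<close>.
\<close>

definition master_poly :: "nat \<Rightarrow> (nat \<Rightarrow> nat) \<Rightarrow> (nat \<Rightarrow> nat \<Rightarrow> nat) \<Rightarrow> int mpoly poly" where
  "master_poly n M MM =
     (\<Prod>a\<in>{1..n}. \<Prod>b\<in>{a<..n}. [:zvar a - zvar b:] ^ MM a b) *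
     (\<Prod>a\<in>{1..n}. [:- zvar a, 1:] ^ M a)"

text \<open>
  The coordinate \<open>\<Phi>(t,z) / (t - z\<^sub>j)\<close>: \<^const>\<open>synthetic_div\<close> is the quotient of the division by
  \<open>t - z\<^sub>j\<close>, and the division is exact when \<open>M j \<ge> 1\<close> (lemma \<open>master_coord_mult\<close>).
\<close>

definition master_coord ::
    "nat \<Rightarrow> (nat \<Rightarrow> nat) \<Rightarrow> (nat \<Rightarrow> nat \<Rightarrow> nat) \<Rightarrow> nat \<Rightarrow> int mpoly poly" where
  "master_coord n M MM j = synthetic_div (master_poly n M MM) (zvar j)"

text \<open>
  The coefficient of \<open>(t - q)\<^sup>i\<close> in the \<open>j\<close>-th coordinate, obtained by substituting \<open>t + q\<close> for \<open>t\<close>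
  (see lemma \<open>I_bar_expansion\<close>).
\<close>

definition I_bar ::
    "nat \<Rightarrow> (nat \<Rightarrow> nat) \<Rightarrow> (nat \<Rightarrow> nat \<Rightarrow> nat) \<Rightarrow> nat \<Rightarrow> int \<Rightarrow> nat \<Rightarrow> int mpoly" where
  "I_bar n M MM i q j = coeff (pcompose (master_coord n M MM j) [:of_int q, 1:]) i"

text \<open>
  For \<open>q\<close> in the prime field, the representative of \<open>q\<close> in \<open>{0..<p}\<close> is used; any other integer
  representative gives the same result (lemma \<open>I_modp_of_int\<close>).
\<close>

definition I_modp ::
    "nat \<Rightarrow> (nat \<Rightarrow> nat) \<Rightarrow> (nat \<Rightarrow> nat \<Rightarrow> nat) \<Rightarrow> nat \<Rightarrow> 'p :: prime_card mod_ring \<Rightarrow> nat \<Rightarrow>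
     'p mod_ring mpoly" where
  "I_modp n M MM i q j = mp_reduce (I_bar n M MM i (to_int_mod_ring q) j)"

definition F_coord ::
    "nat \<Rightarrow> (nat \<Rightarrow> nat) \<Rightarrow> (nat \<Rightarrow> nat \<Rightarrow> nat) \<Rightarrow> (nat \<Rightarrow> 'p :: prime_card mod_ring) \<Rightarrow> nat \<Rightarrow>
     'p mod_ring poly" where
  "F_coord n M MM x j = map_poly (\<lambda>c. mp_eval x (mp_reduce c)) (master_coord n M MM j)"

text \<open>
  For \<open>n \<ge> 1\<close>; zero coordinates count as having degree 0.
\<close>

definition F_degree ::
    "nat \<Rightarrow> (nat \<Rightarrow> nat) \<Rightarrow> (nat \<Rightarrow> nat \<Rightarrow> nat) \<Rightarrow> (nat \<Rightarrow> 'p :: prime_card mod_ring) \<Rightarrow> nat" where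
  "F_degree n M MM x = Max ((\<lambda>j. degree (F_coord n M MM x j)) ` {1..n})"

definition Fp_integral :: "'p :: prime_card mod_ring poly \<Rightarrow> 'p mod_ring" where
  "Fp_integral f = (\<Sum>t\<in>UNIV. poly f t)"


lemma master_coord_mult:
  assumes "j \<in> {1..n}" "M j \<ge> 1"
  shows "[:- zvar j, 1:] * master_coord n M MM j = master_poly n M MM"
proof -
  have "poly (\<Prod>a\<in>{1..n}. [:- zvar a, 1:] ^ M a) (zvar j :: int mpoly) = 0"
    unfolding poly_prod by (rule prod_zero) (use assms in \<open>auto intro!: bexI[of _ j]\<close>)
  then have "poly (master_poly n M MM) (zvar j) = 0"
    by (simp add: master_poly_def)
  then show ?thesis
    using synthetic_div_correct'[of "zvar j" "master_poly n M MM"]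
    by (simp add: master_coord_def)
qed

lemma I_bar_expansion:
  "master_coord n M MM j =
     (\<Sum>i\<le>degree (master_coord n M MM j).
        Polynomial.smult (I_bar n M MM i q j) ([:- of_int q, 1:] ^ i))"
proof -
  define p where "p = master_coord n M MM j"
  define r where "r = pcompose p [:of_int q, 1:]"
  have deg: "degree r = degree p"
    unfolding r_def by (subst degree_pcompose) simp
  have "p = pcompose r [:- of_int q, 1:]"
    unfolding r_def pcompose_assoc[symmetric] by (simp add: pcompose_pCons)
  also have "\<dots> = pcompose (\<Sum>i\<le>degree r. monom (coeff r i) i) [:- of_int q, 1:]"
    by (simp add: poly_as_sum_of_monoms)
  also have "\<dots> = (\<Sum>i\<le>degree r. Polynomial.smult (coeff r i) ([:- of_int q, 1:] ^ i))"
    by (simp add: pcompose_sum) (simp add: pcompose_altdef map_poly_monom poly_monom)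
  finally show ?thesis
    unfolding deg by (simp only: p_def r_def I_bar_def)
qed

lemma lookup_mp_reduce:
  "Poly_Mapping.lookup (mp_reduce P) u = of_int (Poly_Mapping.lookup P u)"
  by (simp add: mp_reduce_def Poly_Mapping.map.rep_eq when_def)

lemma mp_reduce_add: "mp_reduce (P + Q) = mp_reduce P + mp_reduce Q"
  by (rule poly_mapping_eqI) (simp add: lookup_mp_reduce lookup_add)

lemma mp_reduce_single:
  "mp_reduce (Poly_Mapping.single u c) = Poly_Mapping.single u (of_int c)"
  by (rule poly_mapping_eqI) (simp add: lookup_mp_reduce lookup_single when_def)

lemma mp_induct [case_names single add]:
  fixes P :: "'b \<Rightarrow>\<^sub>0 'a :: comm_monoid_add"
  assumes "\<And>u c. A (Poly_Mapping.single u c)" "\<And>P Q. A P \<Longrightarrow> A Q \<Longrightarrow> A (P + Q)"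
  shows "A P"
proof (induction P rule: update_induct)
  case const
  show ?case using assms(1)[of _ 0] by simp
next
  case (update P u c)
  have "Poly_Mapping.update u c P = P + Poly_Mapping.single u c"
    using update.hyps(1)
    by (intro poly_mapping_eqI)
      (auto simp: lookup_update lookup_add lookup_single when_def in_keys_iff)
  then show ?case using assms update.IH by auto
qed

lemma mp_reduce_mult: "mp_reduce (P * Q) = mp_reduce P * mp_reduce Q"
proof (induction P rule: mp_induct)
  case (single u c)
  show ?case
    by (induction Q rule: mp_induct)
      (simp_all add: mult_single mp_reduce_single mp_reduce_add distrib_left)
qed (simp add: mp_reduce_add distrib_right)

lemma comm_ring_hom_mp_reduce: "comm_ring_hom mp_reduce"
proof
  show "mp_reduce 0 = 0"
    using mp_reduce_single[of 0 0] by simp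
  show "mp_reduce 1 = 1"
    using mp_reduce_single[of 0 1] by simp
qed (rule mp_reduce_add mp_reduce_mult)+

lemma I_modp_of_int: "I_modp n M MM i (of_int q) j = (mp_reduce (I_bar n M MM i q j) :: 'p :: prime_card mod_ring mpoly)"
proof -
  interpret comm_ring_hom "mp_reduce :: _ \<Rightarrow> 'p mod_ring mpoly" by (rule comm_ring_hom_mp_reduce)
  have of_int_cong: "(of_int a :: 'p mod_ring mpoly) = of_int b"
    if "(of_int a :: 'p mod_ring) = of_int b" for a b
    using that by (metis mp_reduce_single hom_of_int single_of_int)
  have *: "(mp_reduce (I_bar n M MM i q j) :: 'p mod_ring mpoly) =
      coeff (pcompose (map_poly mp_reduce (master_coord n M MM j)) [:of_int q, 1:]) i" for q
  proof -
    interpret h: map_poly_comm_ring_hom "mp_reduce :: _ \<Rightarrow> 'p mod_ring mpoly" ..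
    show ?thesis
      by (simp add: I_bar_def map_poly_pcompose hom_of_int flip: coeff_map_poly_hom)
  qed
  have "of_int (to_int_mod_ring (of_int q :: 'p mod_ring)) = (of_int q :: 'p mod_ring)"
    by (simp add: of_int_of_int_mod_ring)
  from of_int_cong[OF this] show ?thesis
    unfolding I_modp_def * by simp
qed

end

theory Submission
  imports Defs "Berlekamp_Zassenhaus.Berlekamp_Type_Based"
begin

text \<open>
  Evaluation at \<open>x\<close> after reduction modulo \<open>p\<close> is a ring homomorphism, so it commutes with the
  substitution \<open>t \<mapsto> t + q\<close> and with taking coefficients: the left-hand side is the coefficient
  of \<open>t\<^bsup>p-1\<^esup>\<close> in the polynomial \<open>g(t) = f(t + q)\<close>, where \<open>f\<close> is the \<open>j\<close>-th coordinate of
  \<open>F\<close>. The translation \<open>t \<mapsto> t + q\<close> permutes the prime field, so \<open>f\<close> and \<open>g\<close> have the same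
  integral. Finally, the sum of \<open>t\<^sup>i\<close> over the prime field is \<open>-1\<close> if \<open>i\<close> is a positive multiple
  of \<open>p - 1\<close>, and \<open>0\<close> otherwise (lemma \<open>sum_powers_mod_ring\<close>). As \<open>deg g = deg f < 2(p - 1)\<close>,
  the only exponent of \<open>g\<close> that contributes to the integral is \<open>p - 1\<close>
  (lemma \<open>Fp_integral_eq_coeff\<close>).
\<close>

lemma mp_eval_eq_sum_superset:
  assumes "finite A" "Poly_Mapping.keys P \<subseteq> A"
  shows "mp_eval x P = (\<Sum>u\<in>A. Poly_Mapping.lookup P u *
           (\<Prod>a\<in>Poly_Mapping.keys u. x a ^ Poly_Mapping.lookup u a))"
  unfolding mp_eval_def using assms by (intro sum.mono_neutral_left) (auto simp: in_keys_iff)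

lemma mp_eval_add: "mp_eval x (P + Q) = mp_eval x P + mp_eval x Q"
proof -
  define A where "A = Poly_Mapping.keys P \<union> Poly_Mapping.keys Q"
  have A: "finite A" "Poly_Mapping.keys P \<subseteq> A" "Poly_Mapping.keys Q \<subseteq> A"
    "Poly_Mapping.keys (P + Q) \<subseteq> A"
    using Poly_Mapping.keys_add[of P Q] by (auto simp: A_def)
  show ?thesis
    unfolding A(2-)[THEN mp_eval_eq_sum_superset[OF A(1)]]
    by (simp add: lookup_add distrib_right sum.distrib)
qed

lemma mp_eval_single:
  "mp_eval x (Poly_Mapping.single u c) =
     c * (\<Prod>a\<in>Poly_Mapping.keys u. x a ^ Poly_Mapping.lookup u a)"
  by (subst mp_eval_eq_sum_superset[of "{u}"]) auto

lemma prod_monomial_add: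
  fixes x :: "'b \<Rightarrow> 'a :: comm_semiring_1" and u v :: "'b \<Rightarrow>\<^sub>0 nat"
  shows "(\<Prod>a\<in>Poly_Mapping.keys (u + v). x a ^ Poly_Mapping.lookup (u + v) a) =
    (\<Prod>a\<in>Poly_Mapping.keys u. x a ^ Poly_Mapping.lookup u a) *
    (\<Prod>a\<in>Poly_Mapping.keys v. x a ^ Poly_Mapping.lookup v a)"
proof -
  define A where "A = Poly_Mapping.keys u \<union> Poly_Mapping.keys v"
  have *: "(\<Prod>a\<in>Poly_Mapping.keys w. x a ^ Poly_Mapping.lookup w a) =
      (\<Prod>a\<in>A. x a ^ Poly_Mapping.lookup w a)"
    if "Poly_Mapping.keys w \<subseteq> A" for w
    using that by (intro prod.mono_neutral_left) (auto simp: A_def in_keys_iff)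
  have A: "Poly_Mapping.keys u \<subseteq> A" "Poly_Mapping.keys v \<subseteq> A" "Poly_Mapping.keys (u + v) \<subseteq> A"
    using Poly_Mapping.keys_add[of u v] by (auto simp: A_def)
  show ?thesis
    unfolding A[THEN *] by (simp add: lookup_add power_add prod.distrib)
qed

lemma mp_eval_mult: "mp_eval x (P * Q) = mp_eval x P * mp_eval x Q"
proof (induction P rule: mp_induct)
  case (single u c)
  show ?case
    by (induction Q rule: mp_induct)
      (simp_all add: mult_single mp_eval_single mp_eval_add prod_monomial_add algebra_simps)
qed (simp add: mp_eval_add distrib_right)

lemma comm_ring_hom_mp_eval:
  "comm_ring_hom (mp_eval x :: 'a :: comm_ring_1 mpoly \<Rightarrow> 'a)"
proof
  show "mp_eval x 0 = 0"
    by (simp add: mp_eval_def)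
  show "mp_eval x 1 = 1"
    using mp_eval_single[of x 0 1] by simp
qed (rule mp_eval_add mp_eval_mult)+

lemma mp_eval_I_modp:
  fixes x :: "nat \<Rightarrow> 'p :: prime_card mod_ring"
  shows "mp_eval x (I_modp n M MM i q j) = coeff (pcompose (F_coord n M MM x j) [:q, 1:]) i"
proof -
  interpret r: comm_ring_hom "mp_reduce :: _ \<Rightarrow> 'p mod_ring mpoly"
    by (rule comm_ring_hom_mp_reduce)
  interpret e: comm_ring_hom "mp_eval x"
    by (rule comm_ring_hom_mp_eval)
  interpret h: comm_ring_hom "\<lambda>c. mp_eval x (mp_reduce c)"
    by unfold_locales (simp_all add: mp_reduce_add mp_reduce_mult mp_eval_add mp_eval_mult)
  interpret mh: map_poly_comm_ring_hom "\<lambda>c. mp_eval x (mp_reduce c)" ..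
  have q: "of_int (to_int_mod_ring q) = q"
    by (simp add: of_int_of_int_mod_ring)
  show ?thesis
    by (simp add: I_modp_def I_bar_def F_coord_def h.map_poly_pcompose h.hom_of_int q
        flip: h.coeff_map_poly_hom)
qed

lemma mod_ring_power_CARD_minus_1:
  fixes a :: "'p :: prime_card mod_ring"
  assumes "a \<noteq> 0"
  shows "a ^ (CARD('p) - 1) = 1"
proof -
  have "a * a ^ (CARD('p) - 1) = a * 1"
    using fermat_theorem_mod_ring[of a] prime_card[where 'a = 'p]
    by (simp flip: power_Suc add: prime_gt_0_nat)
  with assms show ?thesis by (simp only: mult_cancel_left) simp
qed

text \<open>
  If \<open>p - 1\<close> does not divide \<open>i\<close>, then some unit \<open>a\<close> has \<open>a\<^sup>i \<noteq> 1\<close>, because otherwise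
  \<open>t\<^sup>r - 1\<close> with \<open>r = i mod (p - 1)\<close> would have \<open>p - 1 > r\<close> roots. Multiplication by \<open>a\<close>
  permutes the field and multiplies the sum by \<open>a\<^sup>i\<close>, which forces the sum to vanish. For
  \<open>i = 0\<close> the summand at \<open>t = 0\<close> is \<open>0\<^sup>0 = 1\<close>, so that the sum is \<open>p = 0\<close> rather than \<open>-1\<close>.
\<close>

lemma sum_powers_mod_ring:
  "(\<Sum>t\<in>UNIV. (t :: 'p :: prime_card mod_ring) ^ i) =
     (if i > 0 \<and> (CARD('p) - 1) dvd i then -1 else 0)"
proof -
  let ?p = "CARD('p)"
  have p: "?p > 1" using prime_card[where 'a = 'p] by (rule prime_gt_1_nat)
  have p0: "of_nat ?p = (0 :: 'p mod_ring)"
    using of_nat_0_mod_ring_dvd[where 'a = 'p, of ?p] by simp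
  consider "i = 0" | "i > 0" "(?p - 1) dvd i" | "\<not> (?p - 1) dvd i" by auto
  then show ?thesis
  proof cases
    case 1
    then show ?thesis using p0 by simp
  next
    case 2
    then obtain k where k: "i = (?p - 1) * k" by auto
    have "(\<Sum>t\<in>UNIV. (t :: 'p mod_ring) ^ i) = (\<Sum>t\<in>UNIV - {0}. (t :: 'p mod_ring) ^ i)"
      using 2 by (intro sum.mono_neutral_right) auto
    also have "\<dots> = (\<Sum>t\<in>UNIV - {0 :: 'p mod_ring}. 1)"
      by (intro sum.cong) (auto simp: k power_mult mod_ring_power_CARD_minus_1 simp del: One_nat_def)
    also have "\<dots> = of_nat (?p - 1)"
      by (simp add: card_Diff_singleton)
    also have "\<dots> = -1"
      using p p0 by (simp add: of_nat_diff)
    finally show ?thesis using 2 by simp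
  next
    case 3
    define r where "r = i mod (?p - 1)"
    have r: "0 < r" "r < ?p - 1"
      using 3 p by (auto simp: r_def mod_greater_zero_iff_not_dvd)
    define f :: "'p mod_ring poly" where "f = monom 1 r - 1"
    have f: "f \<noteq> 0" "degree f \<le> r"
    proof -
      have "coeff f r = 1" using r by (simp add: f_def)
      then show "f \<noteq> 0" by auto
      show "degree f \<le> r"
        unfolding f_def by (intro degree_diff_le) (auto simp: degree_monom_le)
    qed
    have "\<exists>a :: 'p mod_ring. a \<noteq> 0 \<and> a ^ i \<noteq> 1"
    proof (rule ccontr)
      assume no: "\<not> ?thesis"
      have "a ^ r = 1" if "a \<noteq> 0" for a :: "'p mod_ring"
      proof -
        have "1 = a ^ ((?p - 1) * (i div (?p - 1)) + r)"
          using no that by (auto simp: r_def)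
        also have "\<dots> = a ^ r"
          using that by (simp add: power_add power_mult mod_ring_power_CARD_minus_1 del: One_nat_def)
        finally show ?thesis by simp
      qed
      then have "UNIV - {0} \<subseteq> {a. poly f a = 0}"
        by (auto simp: f_def poly_monom)
      then have "card (UNIV - {0 :: 'p mod_ring}) \<le> card {a. poly f a = 0}"
        by (intro card_mono) auto
      also have "\<dots> \<le> r"
        using card_poly_roots_bound[OF f(1)] f(2) by simp
      finally show False using r by (simp add: card_Diff_singleton)
    qed
    then obtain a :: "'p mod_ring" where a: "a \<noteq> 0" "a ^ i \<noteq> 1" by auto
    let ?S = "\<Sum>t\<in>UNIV. (t :: 'p mod_ring) ^ i"
    have "?S = (\<Sum>t\<in>UNIV. (a * t) ^ i)"
      by (rule sum.reindex_bij_witness[of _ "\<lambda>t. a * t" "\<lambda>t. t / a"]) (use a in auto)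
    also have "\<dots> = a ^ i * ?S"
      by (simp add: power_mult_distrib sum_distrib_left)
    finally have "(1 - a ^ i) * ?S = 0"
      by (simp add: algebra_simps)
    with a 3 show ?thesis by auto
  qed
qed

lemma Fp_integral_translate:
  "Fp_integral (pcompose f [:q, 1:]) = Fp_integral f"
  unfolding Fp_integral_def
  by (rule sum.reindex_bij_witness[of _ "\<lambda>t. t - q" "\<lambda>t. q + t"])
    (simp_all add: poly_pcompose)

text \<open>
  The next exponent after \<open>p - 1\<close> with a nonzero power sum is \<open>2(p - 1)\<close>, whence the bound
  on the degree.
\<close>

lemma Fp_integral_eq_coeff:
  fixes f :: "'p :: prime_card mod_ring poly"
  assumes "degree f < 2 * CARD('p) - 2"
  shows "Fp_integral f = - coeff f (CARD('p) - 1)"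
proof -
  let ?p = "CARD('p)"
  have p: "?p > 1" using prime_card[where 'a = 'p] by (rule prime_gt_1_nat)
  have i: "i > 0 \<and> (?p - 1) dvd i \<longleftrightarrow> i = ?p - 1" if "i < 2 * ?p - 2" for i
  proof
    assume "i > 0 \<and> (?p - 1) dvd i"
    then obtain k where k: "i = (?p - 1) * k" "k > 0" by (auto elim!: dvdE)
    have "(?p - 1) * k < (?p - 1) * 2" using that k by (simp add: algebra_simps)
    then show "i = ?p - 1" using k by simp
  qed (use p in auto)
  have "Fp_integral f = (\<Sum>t\<in>UNIV. \<Sum>i<2 * ?p - 2. coeff f i * t ^ i)"
    unfolding Fp_integral_def poly_altdef using assms
    by (intro sum.cong sum.mono_neutral_left) (auto simp: coeff_eq_0)
  also have "\<dots> = (\<Sum>i<2 * ?p - 2. coeff f i * (\<Sum>t\<in>UNIV. t ^ i))"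
    by (subst sum.swap) (simp add: sum_distrib_left)
  also have "\<dots> = (\<Sum>i<2 * ?p - 2. if i = ?p - 1 then - coeff f i else 0)"
    by (intro sum.cong) (simp_all add: sum_powers_mod_ring i del: One_nat_def)
  also have "\<dots> = - coeff f (?p - 1)"
    using p by (subst sum.delta) auto
  finally show ?thesis .
qed

theorem theorem1p3:
  fixes n \<kappa> :: nat and m M :: "nat \<Rightarrow> nat" and MM :: "nat \<Rightarrow> nat \<Rightarrow> nat"
    and x :: "nat \<Rightarrow> 'p :: prime_card mod_ring" and q :: "'p mod_ring"
  assumes "n \<ge> 1"
    and "\<kappa> > 0"
    and "\<And>a. a \<in> {1..n} \<Longrightarrow> m a > 0"
    and "CARD('p) > 2"
    and "\<not> CARD('p) dvd \<kappa>"
    and "\<And>a. a \<in> {1..n} \<Longrightarrow> M a > 0"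
    and "\<And>a b. 1 \<le> a \<Longrightarrow> a < b \<Longrightarrow> b \<le> n \<Longrightarrow> MM a b > 0"
    and "\<And>a. a \<in> {1..n} \<Longrightarrow>
           (of_nat (M a) :: 'p mod_ring) = - (of_nat (m a) / of_nat \<kappa>)"
    and "\<And>a b. 1 \<le> a \<Longrightarrow> a < b \<Longrightarrow> b \<le> n \<Longrightarrow>
           (of_nat (MM a b) :: 'p mod_ring) = of_nat (m a) * of_nat (m b) / (2 * of_nat \<kappa>)"
    and "F_degree n M MM x < 2 * CARD('p) - 2"
  shows "\<forall>j\<in>{1..n}.
           mp_eval x (I_modp n M MM (CARD('p) - 1) q j) = - Fp_integral (F_coord n M MM x j)"
proof
  fix j assume j: "j \<in> {1..n}"
  let ?f = "F_coord n M MM x j"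
  have "degree ?f \<le> F_degree n M MM x"
    unfolding F_degree_def using j by (intro Max_ge) auto
  then have "degree (pcompose ?f [:q, 1:]) < 2 * CARD('p) - 2"
    using assms(10) by (simp add: degree_pcompose)
  then show "mp_eval x (I_modp n M MM (CARD('p) - 1) q j) = - Fp_integral ?f"
    using Fp_integral_eq_coeff Fp_integral_translate[of ?f q] by (metis minus_minus mp_eval_I_modp)
qed

end
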